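(* Let $I\subset\mathbb{R}$ be an open interval, let $\mu$ be a finite absolutely continuous Borel measure on $I$, and suppose $\mathbb{P}_{2n-1}$ is $\mu$-integrable on $I$. The nodes of a Gaussian quadrature of order $n$ on $I$ are the same as the points $\mathbf{x}$ in the unique bilinear quadrature $Q(f,g)=f(\mathbf{x})^{*}Wg(\mathbf{y})$ of order $(n,n)$ that is exact on $\mathbb{P}_{n-1}\times\mathbb{P}_{n-1}$ and minimal on $\operatorname{span}\{\phi_n\}$, where $\phi_n$ is the orthonormal polynomial of degree $n$. Furthermore, the matrix $W$ of this bilinear quadrature is a diagonal matrix whose diagonal entries are the weights of the Gaussian quadrature.
   Context: $\mathbb{P}_j$ is the space of univariate polynomials of degree at most $j$. The orthonormal polynomial $\phi_n$ is the degree-$n$ member of a set $\{\phi_k\}$ of $L^2(I,\mu)$-orthonormal polynomials with $\deg\phi_k=k$. A Gaussian quadrature of order $n$ on $I$ (with respect to $\mu$) consists of nodes $x_1,\dots,x_n\in I$ and weights $w_1,\dots,w_n\in\mathbb{R}$ such that $\sum_{i=1}^nw_ip(x_i)=\int_Ip\,d\mu$ for all $p\in\mathbb{P}_{2n-1}$. A bilinear quadrature of order $(n,n)$ here is a bilinear form $Q(f,g)=f(\mathbf{x})^{*}Wg(\mathbf{y})$ given by points $\mathbf{x}=(x_1,\dots,x_n)\in I^n$, $\mathbf{y}=(y_1,\dots,y_n)\in I^n$ and a matrix $W\in\mathbb{R}^{n\times n}$, where $f(\mathbf{x})=(f(x_1),\dots,f(x_n))^{*}$ and $g(\mathbf{y})=(g(y_1),\dots,g(y_n))^{*}$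 are column vectors and $^{*}$ is transpose. It is exact on $\mathbb{P}_{n-1}\times\mathbb{P}_{n-1}$ if $Q(f,g)=\int_Ifg\,d\mu$ for all $f,g\in\mathbb{P}_{n-1}$. Let $\mathcal{Q}$ be the set of such quadratures exact on $\mathbb{P}_{n-1}\times\mathbb{P}_{n-1}$. For a finite-dimensional space $\mathcal{G}_1$ of functions that are $L^2(I,\mu)$-orthogonal to $\mathbb{P}_{n-1}$, $Q\in\mathcal{Q}$ is minimal on $\mathcal{G}_1$ if it minimizes over $\mathcal{Q}$ the quantity $$\sigma(Q)=\max_{0\ne f\in\mathbb{P}_{n-1},\ 0\neq g\in\mathcal{G}_1}\frac{|Q(f,g)|}{\|f\|_{L^2(I,\mu)}\|g\|_{L^2(I,\mu)}}.$$
   Formalization: For independent x and y uniqueness fails (n=1: μ(I)f(x)g(x₁), x₁ the Gauss node, is minimal for every x in I), so uniqueness (up to relabelling the points) and diagonality of W are claimed for quadratures with x = y; for general x, y, minimal means exact with y the Gauss nodes. *)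

theory Defs
  imports "HOL-Analysis.Analysis" "HOL-Computational_Algebra.Polynomial"
begin

text \<open>
  A measure on an interval \<open>I\<close> is represented by a measure \<open>M\<close> with \<open>space M = I\<close>, so that
  \<open>LINT z|M. f z\<close> is the integral over \<open>I\<close>. The order \<open>n\<close> of a quadrature is
  \<open>CARD('n)\<close> for a finite index type \<open>'n\<close>; in particular \<open>n \<ge> 1\<close>.
\<close>

definition poly_space :: "nat \<Rightarrow> (real \<Rightarrow> real) set" where
  "poly_space j = {poly p | p. degree p \<le> j}"

definition L2norm :: "real measure \<Rightarrow> (real \<Rightarrow> real) \<Rightarrow> real" where
  "L2norm M f = sqrt (LINT z|M. (f z)\<^sup>2)"

text \<open>
  The family is only required up to degree \<open>n\<close>, since higher moments of \<open>M\<close> need not exist.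
\<close>

definition orthonormal_polys :: "real measure \<Rightarrow> nat \<Rightarrow> (nat \<Rightarrow> real poly) \<Rightarrow> bool" where
  "orthonormal_polys M n \<phi> \<longleftrightarrow>
     (\<forall>k\<le>n. degree (\<phi> k) = k \<and> integrable M (\<lambda>z. (poly (\<phi> k) z)\<^sup>2)) \<and>
     (\<forall>j\<le>n. \<forall>k\<le>n. (LINT z|M. poly (\<phi> j) z * poly (\<phi> k) z) = (if j = k then 1 else 0))"

definition gauss_quadrature :: "real measure \<Rightarrow> real ^ 'n \<Rightarrow> real ^ 'n \<Rightarrow> bool" where
  "gauss_quadrature M x w \<longleftrightarrow>
     (\<forall>i. x $ i \<in> space M) \<and>
     (\<forall>p \<in> poly_space (2 * CARD('n) - 1). (\<Sum>i\<in>UNIV. w $ i * p (x $ i)) = (LINT z|M. p z))"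

text \<open>A bilinear quadrature of order \<open>(n,n)\<close> is given by its points and its matrix \<open>(x, y, W)\<close>.\<close>

type_synonym 'n bilinear_quadrature = "(real ^ 'n) \<times> (real ^ 'n) \<times> (real ^ 'n ^ 'n)"

fun bq_eval :: "'n::finite bilinear_quadrature \<Rightarrow> (real \<Rightarrow> real) \<Rightarrow> (real \<Rightarrow> real) \<Rightarrow> real" where
  "bq_eval (x, y, W) f g = (\<chi> i. f (x $ i)) \<bullet> (W *v (\<chi> j. g (y $ j)))"

definition exact_bqs :: "real measure \<Rightarrow> 'n::finite bilinear_quadrature set" where
  "exact_bqs M =
     {(x, y, W). (\<forall>i. x $ i \<in> space M \<and> y $ i \<in> space M) \<and>
        (\<forall>f \<in> poly_space (CARD('n) - 1). \<forall>g \<in> poly_space (CARD('n) - 1).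
           bq_eval (x, y, W) f g = (LINT z|M. f z * g z))}"

text \<open>
  The maximum in the definition of \<open>\<sigma>\<close> is taken as a supremum in \<open>ennreal\<close>, where it always
  exists; it is attained, by compactness, for the finite-dimensional spaces \<open>G\<close> considered.
\<close>

definition bq_sigma :: "real measure \<Rightarrow> (real \<Rightarrow> real) set \<Rightarrow> 'n::finite bilinear_quadrature \<Rightarrow> ennreal" where
  "bq_sigma M G Q =
     (SUP (f, g) \<in> (poly_space (CARD('n) - 1) - {\<lambda>_. 0}) \<times> (G - {\<lambda>_. 0}).
        ennreal (\<bar>bq_eval Q f g\<bar> / (L2norm M f * L2norm M g)))"

definition minimal_bq :: "real measure \<Rightarrow> (real \<Rightarrow> real) set \<Rightarrow> 'n::finite bilinear_quadrature \<Rightarrow> bool" where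
  "minimal_bq M G Q \<longleftrightarrow>
     Q \<in> exact_bqs M \<and>
     (\<forall>Q' \<in> (exact_bqs M :: 'n bilinear_quadrature set). bq_sigma M G Q \<le> bq_sigma M G Q')"

definition line_span :: "(real \<Rightarrow> real) \<Rightarrow> (real \<Rightarrow> real) set" where
  "line_span g = {\<lambda>z. c * g z | c. True}"

definition diag_matrix :: "real ^ 'n \<Rightarrow> real ^ 'n ^ 'n" where
  "diag_matrix w = (\<chi> i j. if i = j then w $ i else 0)"

end

theory Submission
  imports Defs
begin

text \<open>
  Expand everything in the orthonormal basis \<open>\<phi>\<^sub>0, \<dots>, \<phi>\<^bsub>n-1\<^esub>\<close>. With the square matrices
  \<open>A = (\<phi>\<^sub>k (x\<^sub>i))\<close> and \<open>B = (\<phi>\<^sub>k (y\<^sub>i))\<close>, exactness of \<open>(x, y, W)\<close> says \<open>A\<^sup>T W B = 1\<close>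
  (\<open>exact_imp_node_matrix\<close>). Hence \<open>A\<close>, \<open>B\<close> and \<open>W\<close> are invertible, the nodes are distinct, and
  the nodes determine \<open>W\<close> (\<open>exact_matrix_unique\<close>). On the line spanned by \<open>\<phi>\<^sub>n\<close>, the quantity \<open>\<sigma>\<close>
  is the size of \<open>A\<^sup>T W\<close> applied to the vector \<open>\<phi>\<^sub>n(y)\<close>; as \<open>A\<^sup>T W\<close> is invertible, \<open>\<sigma>\<close> vanishes
  exactly when every \<open>y\<^sub>j\<close> is a root of \<open>\<phi>\<^sub>n\<close> (\<open>bq_sigma_eq_0_iff\<close>).

  Gaussian nodes realise this least possible value: if \<open>(x, w)\<close> is a Gaussian quadrature, then
  \<open>(x, x, diag w)\<close> is exact, since products of two polynomials of degree below \<open>n\<close> have degree at most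
  \<open>2n - 2\<close>, and the \<open>x\<^sub>i\<close> are roots of \<open>\<phi>\<^sub>n\<close>, since \<open>\<phi>\<^sub>k \<phi>\<^sub>n\<close> with \<open>k < n\<close> has degree at most
  \<open>2n - 1\<close> and integral zero. Conversely, an exact bilinear quadrature whose right nodes are roots
  of \<open>\<phi>\<^sub>n\<close> integrates polynomials of degree below \<open>n\<close> when its first argument is \<open>1\<close>, and division
  by \<open>\<phi>\<^sub>n\<close> raises this to degree \<open>2n - 1\<close> (\<open>gauss_quadrature_if_interpolatory\<close>).

  So once some Gaussian quadrature exists, the minimum of \<open>\<sigma>\<close> is zero, and the minimal quadratures are the
  exact ones with Gaussian right nodes (\<open>minimal_iff_gauss\<close>). Existence is the classical
  sign-change argument: a polynomial of degree below \<open>n\<close> is orthogonal to \<open>\<phi>\<^sub>n\<close> and therefore cannot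
  absorb all its sign changes on the interval, which forces \<open>n\<close> distinct roots there
  (\<open>phi_has_n_roots\<close>). Uniqueness up to a permutation holds because the nodes enumerate the \<open>n\<close> roots of
  \<open>\<phi>\<^sub>n\<close> and determine the matrix.
\<close>

section \<open>Sign changes and zero sets of real polynomials\<close>

text \<open>
  The witness is the set of roots of odd multiplicity in the interval, built by induction on the
  degree: splitting off one root \<open>z\<close> toggles the membership of \<open>z\<close> in the set, and the product
  with the linear factors changes at most by the factor \<open>(t - z)\<^sup>2\<close>. Without roots in the interval
  the sign is constant by the intermediate value theorem.
\<close>
lemma poly_sign_change_set:
  fixes p :: "real poly" and I :: "real set"
  assumes "is_interval I" and "p \<noteq> 0"
  shows "\<exists>S. finite S \<and> S \<subseteq> {z \<in> I. poly p z = 0} \<and>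
           ((\<forall>z\<in>I. 0 \<le> poly (p * (\<Prod>s\<in>S. [:-s, 1:])) z) \<or>
            (\<forall>z\<in>I. poly (p * (\<Prod>s\<in>S. [:-s, 1:])) z \<le> 0))"
  using \<open>p \<noteq> 0\<close>
proof (induction "degree p" arbitrary: p rule: less_induct)
  case less
  show ?case
  proof (cases "\<exists>z\<in>I. poly p z = 0")
    case False
    have "connected (poly p ` I)"
      using assms(1) by (intro connected_continuous_image continuous_intros)
        (simp add: is_interval_connected)
    then have "0 \<in> poly p ` I"
      if "a \<in> I" "b \<in> I" "poly p a < 0" "0 < poly p b" for a b
      using connectedD_interval[of "poly p ` I" "poly p a" "poly p b" 0] that by force
    then have "(\<forall>z\<in>I. 0 \<le> poly p z) \<or> (\<forall>z\<in>I. poly p z \<le> 0)"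
      using False by (metis imageE not_le)
    then show ?thesis by (intro exI[of _ "{}"]) simp
  next
    case True
    then obtain z where z: "z \<in> I" "poly p z = 0" by blast
    then obtain r where r: "p = [:-z, 1:] * r" by (metis poly_eq_0_iff_dvd dvdE)
    have r0: "r \<noteq> 0" using r less.prems by auto
    have "degree r < degree p"
      using r0 unfolding r by (subst degree_mult_eq) auto
    from less.hyps[OF this r0] obtain S where S: "finite S" "S \<subseteq> {z \<in> I. poly r z = 0}"
      and sgn: "(\<forall>z\<in>I. 0 \<le> poly (r * (\<Prod>s\<in>S. [:-s, 1:])) z) \<or>
            (\<forall>z\<in>I. poly (r * (\<Prod>s\<in>S. [:-s, 1:])) z \<le> 0)"
      by blast
    have Sp: "S \<subseteq> {z \<in> I. poly p z = 0}" using S r by auto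
    show ?thesis
    proof (cases "z \<in> S")
      case True
      have "p * (\<Prod>s\<in>S - {z}. [:-s, 1:]) = r * (\<Prod>s\<in>S. [:-s, 1:])"
        unfolding r prod.remove[OF S(1) True] by (simp only: mult_ac)
      then show ?thesis using S(1) Sp sgn by (intro exI[of _ "S - {z}"]) auto
    next
      case False
      have eq: "poly (p * (\<Prod>s\<in>insert z S. [:-s, 1:])) t =
          (t - z)\<^sup>2 * poly (r * (\<Prod>s\<in>S. [:-s, 1:])) t" for t
        unfolding r prod.insert[OF S(1) False]
        by (simp add: power2_eq_square algebra_simps del: poly_prod)
      have "(\<forall>t\<in>I. 0 \<le> poly (p * (\<Prod>s\<in>insert z S. [:-s, 1:])) t) \<or>
          (\<forall>t\<in>I. poly (p * (\<Prod>s\<in>insert z S. [:-s, 1:])) t \<le> 0)"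
        unfolding eq using sgn by (meson mult_nonneg_nonneg mult_nonneg_nonpos zero_le_power2)
      then show ?thesis
        using S(1) Sp z by (intro exI[of _ "insert z S"]) blast
    qed
  qed
qed

text \<open>
  This is where absolute continuity enters: it makes finite subsets of the interval null sets, so
  that the measure cannot be concentrated on the roots of a polynomial.
\<close>
lemma AE_poly_nonzero:
  fixes p :: "real poly"
  assumes "open I" and sets: "sets M = sets (restrict_space borel I)"
    and ac: "absolutely_continuous (restrict_space lborel I) M" and "p \<noteq> 0"
  shows "AE z in M. poly p z \<noteq> 0"
proof -
  have I: "I \<in> sets lborel" using \<open>open I\<close> by simp
  have "finite {z. poly p z = 0}" using \<open>p \<noteq> 0\<close> by (rule poly_roots_finite)
  then have "{z \<in> I. poly p z = 0} \<in> null_sets lborel"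
    by (intro finite_imp_null_set_lborel) auto
  then have "{z \<in> I. poly p z = 0} \<in> null_sets (restrict_space lborel I)"
    using I by (subst null_sets_restrict_space) auto
  then have null: "{z \<in> I. poly p z = 0} \<in> null_sets M"
    using ac by (auto simp: absolutely_continuous_def)
  have "space M = I" using sets_eq_imp_space_eq[OF sets] by (simp add: space_restrict_space)
  then show ?thesis using null by (intro AE_I'[OF null]) auto
qed

section \<open>Lagrange interpolation\<close>

lemma poly_eq_0_if_vanishes_at_nodes:
  fixes r :: "real poly" and y :: "real ^ 'n"
  assumes inj: "inj (($) y)" and deg: "degree r < CARD('n)"
    and 0: "\<And>i. poly r (y $ i) = 0"
  shows "r = 0"
proof (rule ccontr)
  assume "r \<noteq> 0"
  then have fin: "finite {z. poly r z = 0}" by (rule poly_roots_finite)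
  have "CARD('n) = card (range (($) y))" using inj by (simp add: card_image)
  also have "\<dots> \<le> card {z. poly r z = 0}" using fin 0 by (intro card_mono) auto
  also have "\<dots> \<le> degree r" using \<open>r \<noteq> 0\<close> by (rule card_poly_roots_bound)
  finally show False using deg by simp
qed

definition lagrange_basis :: "real ^ 'n \<Rightarrow> 'n \<Rightarrow> real poly" where
  "lagrange_basis y i = (\<Prod>j\<in>UNIV - {i}. smult (1 / (y $ i - y $ j)) [:- (y $ j), 1:])"

lemma degree_lagrange_basis: "degree (lagrange_basis (y :: real ^ 'n) i) \<le> CARD('n) - 1"
proof -
  have "degree (lagrange_basis y i)
      \<le> (\<Sum>j\<in>UNIV - {i}. degree (smult (1 / (y $ i - y $ j)) [:- (y $ j), 1:]))"
    unfolding lagrange_basis_def by (rule order_trans[OF degree_prod_sum_le]) (simp_all add: o_def)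
  also have "\<dots> \<le> (\<Sum>j\<in>UNIV - {i}. 1)"
    by (intro sum_mono) auto
  finally show ?thesis by simp
qed

lemma poly_lagrange_basis:
  assumes "inj (($) y)"
  shows "poly (lagrange_basis y i) (y $ j) = (if i = j then 1 else 0)"
proof (cases "i = j")
  case True
  have "poly (lagrange_basis y i) (y $ i) = (\<Prod>k\<in>UNIV - {i}. 1)"
    unfolding lagrange_basis_def poly_prod
    using injD[OF assms, of i] by (intro prod.cong) (auto simp flip: diff_divide_distrib)
  then show ?thesis using True by simp
next
  case False
  then show ?thesis unfolding lagrange_basis_def poly_prod by (auto intro!: prod_zero)
qed

text \<open>
  The difference of both sides has degree below the number of nodes and vanishes at all of them.
\<close>
lemma lagrange_interpolation:
  fixes y :: "real ^ 'n"
  assumes "inj (($) y)" and "degree r < CARD('n)"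
  shows "(\<Sum>i\<in>UNIV. smult (poly r (y $ i)) (lagrange_basis y i)) = r"
proof -
  define s where "s = (\<Sum>i\<in>UNIV. smult (poly r (y $ i)) (lagrange_basis y i))"
  have "degree s \<le> CARD('n) - 1"
    unfolding s_def
    by (intro degree_sum_le order_trans[OF degree_smult_le] degree_lagrange_basis) auto
  then have "degree (r - s) < CARD('n)"
    using assms(2) zero_less_card_finite[where 'a='n] by (intro degree_diff_less) linarith+
  moreover have "poly (r - s) (y $ j) = 0" for j
    unfolding s_def using assms(1)
    by (simp add: poly_sum poly_lagrange_basis if_distrib sum.delta cong: if_cong)
  ultimately have "r - s = 0" by (rule poly_eq_0_if_vanishes_at_nodes[OF assms(1)])
  then have "s = r" by simp
  then show ?thesis unfolding s_def .
qed

section \<open>Orthonormal polynomials\<close>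

lemma poly_in_poly_space: "degree p \<le> j \<Longrightarrow> poly p \<in> poly_space j"
  by (auto simp: poly_space_def)

text \<open>
  The order is a natural number \<open>n\<close> here, so that statements about \<open>\<phi>\<close> alone are free of
  index types; lemmas about nodes assume that their index type has \<open>n\<close> elements.
\<close>
locale orthonormal_family =
  fixes M :: "real measure" and n :: nat and \<phi> :: "nat \<Rightarrow> real poly"
  assumes n_pos: "0 < n"
    and integrable_poly: "\<And>p. degree p \<le> 2 * n - 1 \<Longrightarrow> integrable M (poly p)"
    and orthonormal: "orthonormal_polys M n \<phi>"
begin

lemma degree_phi: "k \<le> n \<Longrightarrow> degree (\<phi> k) = k"
  using orthonormal by (simp add: orthonormal_polys_def)

lemma inner_phi:
  "j \<le> n \<Longrightarrow> k \<le> n \<Longrightarrow> (LINT z|M. poly (\<phi> j) z * poly (\<phi> k) z) = (if j = k then 1 else 0)"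
  using orthonormal by (simp add: orthonormal_polys_def)

lemma phi_nonzero: "k \<le> n \<Longrightarrow> \<phi> k \<noteq> 0"
  using inner_phi[of k k] by auto

lemma L2norm_phi: "k \<le> n \<Longrightarrow> L2norm M (poly (\<phi> k)) = 1"
  using inner_phi[of k k] by (simp add: L2norm_def power2_eq_square)

text \<open>
  Subtracting a multiple of \<open>\<phi> d\<close> from a polynomial of degree \<open>d\<close> cancels the leading term, which
  reduces the claim to smaller degree. Integrability of both parts comes from \<open>n + d \<le> 2n - 1\<close>.
\<close>
lemma phi_orthogonal_lower:
  assumes "degree q < n"
  shows "(LINT z|M. poly (\<phi> n * q) z) = 0"
  using assms
proof (induction "degree q" arbitrary: q rule: less_induct)
  case less
  define d where "d = degree q"
  define c where "c = lead_coeff q / lead_coeff (\<phi> d)"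
  define r where "r = q - smult c (\<phi> d)"
  have d: "d < n" "degree (\<phi> d) = d" using less.prems degree_phi by (auto simp: d_def)
  have c: "coeff r d = 0"
    using d(2) phi_nonzero[of d] less.prems leading_coeff_0_iff[of "\<phi> d"]
    unfolding r_def c_def d_def by simp
  have le: "degree r \<le> d"
    unfolding r_def using d by (intro degree_diff_le order_trans[OF degree_smult_le]) (auto simp: d_def)
  have q: "q = r + smult c (\<phi> d)" by (simp add: r_def)
  have deg: "degree (\<phi> n * s) \<le> 2 * n - 1" if "degree s < n" for s
    using degree_mult_le[of "\<phi> n" s] degree_phi[of n] that by linarith
  have "(LINT z|M. poly (\<phi> n * r) z) = 0"
  proof (cases "r = 0")
    case False
    then have "degree r \<noteq> d" using c by (metis leading_coeff_0_iff)
    then have "degree r < degree q" using le by (simp add: d_def)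
    then show ?thesis using less.hyps[of r] less.prems by linarith
  qed simp
  moreover have "(LINT z|M. poly (\<phi> n * \<phi> d) z) = 0"
    using inner_phi[of n d] d by simp
  moreover have "(LINT z|M. poly (\<phi> n * q) z) =
      (LINT z|M. poly (\<phi> n * r) z + c * poly (\<phi> n * \<phi> d) z)"
    by (rule Bochner_Integration.integral_cong) (simp_all add: q algebra_simps)
  moreover have "integrable M (poly (\<phi> n * r))" "integrable M (poly (\<phi> n * \<phi> d))"
    using d le by (auto intro!: integrable_poly deg)
  ultimately show ?case by (simp del: poly_mult)
qed

text \<open>
  With fewer than \<open>n\<close> sign changes in the interval, the polynomial \<open>q\<close> with simple roots at the
  sign changes is orthogonal to \<open>\<phi> n\<close>, while the product \<open>\<phi> n * q\<close> has constant sign. The product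
  then vanishes almost everywhere, although its zero set is null, so the measure is zero and
  \<open>\<phi> n\<close> cannot have norm one.
\<close>
lemma phi_has_n_roots:
  assumes "is_interval (space M)"
    and null: "\<And>p. p \<noteq> 0 \<Longrightarrow> AE z in M. poly p z \<noteq> 0"
  shows "\<exists>S \<subseteq> space M. finite S \<and> card S = n \<and> (\<forall>z\<in>S. poly (\<phi> n) z = 0)"
proof -
  obtain S where S: "finite S" "S \<subseteq> {z \<in> space M. poly (\<phi> n) z = 0}"
    and sgn: "(\<forall>z\<in>space M. 0 \<le> poly (\<phi> n * (\<Prod>s\<in>S. [:-s, 1:])) z) \<or>
            (\<forall>z\<in>space M. poly (\<phi> n * (\<Prod>s\<in>S. [:-s, 1:])) z \<le> 0)"
    using poly_sign_change_set[OF assms(1) phi_nonzero[OF order_refl]] by blast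
  have "card S \<le> card {z. poly (\<phi> n) z = 0}"
    using S poly_roots_finite phi_nonzero by (intro card_mono) auto
  also have "\<dots> \<le> n"
    using card_poly_roots_bound[of "\<phi> n"] phi_nonzero[of n] degree_phi[of n] by simp
  finally have le: "card S \<le> n" .
  have "\<not> card S < n"
  proof
    assume less: "card S < n"
    define q where "q = (\<Prod>s\<in>S. [:-s, 1:])"
    have q: "degree q = card S" "q \<noteq> 0"
      unfolding q_def using S by (auto simp: degree_prod_eq_sum_degree)
    have int0: "(LINT z|M. poly (\<phi> n * q) z) = 0"
      using less q by (intro phi_orthogonal_lower) simp
    have int: "integrable M (poly (\<phi> n * q))"
      using degree_mult_le[of "\<phi> n" q] degree_phi[of n] q less by (intro integrable_poly) linarith
    have "AE z in M. poly (\<phi> n * q) z = 0"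
      using sgn
    proof
      assume "\<forall>z\<in>space M. 0 \<le> poly (\<phi> n * (\<Prod>s\<in>S. [:-s, 1:])) z"
      then have "AE z in M. 0 \<le> poly (\<phi> n * q) z" by (simp add: q_def)
      then show ?thesis using integral_nonneg_eq_0_iff_AE[OF int] int0 by blast
    next
      assume "\<forall>z\<in>space M. poly (\<phi> n * (\<Prod>s\<in>S. [:-s, 1:])) z \<le> 0"
      then have "AE z in M. 0 \<le> - poly (\<phi> n * q) z" unfolding q_def by simp
      then have "AE z in M. - poly (\<phi> n * q) z = 0"
        using integral_nonneg_eq_0_iff_AE[of M "\<lambda>z. - poly (\<phi> n * q) z"] int int0
        by (simp del: poly_mult)
      then show ?thesis by simp
    qed
    moreover have "AE z in M. poly (\<phi> n * q) z \<noteq> 0"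
      using q phi_nonzero[of n] by (intro null) auto
    ultimately have "AE z in M. False" by eventually_elim simp
    then have "(LINT z|M. poly (\<phi> n) z * poly (\<phi> n) z) = 0"
      by (intro integral_eq_zero_AE) (auto elim: eventually_mono)
    then show False using inner_phi[of n n] by simp
  qed
  then show ?thesis using S le by (intro exI[of _ S]) auto
qed

section \<open>Gaussian quadrature\<close>

text \<open>
  Write \<open>p = \<phi> n * q + r\<close>. The first summand contributes nothing to the integral by orthogonality and
  nothing to the sum because the nodes are roots, so exactness for the remainder is exactness for \<open>p\<close>.
\<close>
lemma gauss_quadrature_if_interpolatory:
  fixes y w :: "real ^ 'n"
  assumes n: "CARD('n) = n"
    and y: "\<And>i. y $ i \<in> space M" "\<And>i. poly (\<phi> n) (y $ i) = 0"
    and w: "\<And>r. degree r < n \<Longrightarrow> (\<Sum>i\<in>UNIV. w $ i * poly r (y $ i)) = (LINT z|M. poly r z)"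
  shows "gauss_quadrature M y w"
proof -
  have "(\<Sum>i\<in>UNIV. w $ i * poly p (y $ i)) = (LINT z|M. poly p z)" if p: "degree p \<le> 2 * n - 1" for p
  proof -
    define q r where "q = p div \<phi> n" and "r = p mod \<phi> n"
    have pqr: "p = \<phi> n * q + r" by (simp add: q_def r_def)
    have phi: "\<phi> n \<noteq> 0" "degree (\<phi> n) = n" using phi_nonzero degree_phi by auto
    have r: "degree r < n"
      using degree_mod_less[of "\<phi> n" p] phi n_pos by (auto simp: r_def)
    have q: "degree q < n"
    proof (cases "q = 0")
      case False
      have "degree (\<phi> n * q) \<le> 2 * n - 1"
        using degree_diff_le[of p "2 * n - 1" r] p r by (simp add: pqr)
      then show ?thesis using False phi n_pos by (simp add: degree_mult_eq)
    qed (use n_pos in simp)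
    have "integrable M (poly (\<phi> n * q))" "integrable M (poly r)"
      using degree_mult_le[of "\<phi> n" q] phi q r by (intro integrable_poly; linarith)+
    then have "(LINT z|M. poly p z) = (LINT z|M. poly (\<phi> n * q) z) + (LINT z|M. poly r z)"
      unfolding pqr poly_add by (rule Bochner_Integration.integral_add)
    also have "\<dots> = (\<Sum>i\<in>UNIV. w $ i * poly r (y $ i))"
      using phi_orthogonal_lower[OF q] w[OF r] by simp
    also have "\<dots> = (\<Sum>i\<in>UNIV. w $ i * poly p (y $ i))"
      using y by (simp add: pqr)
    finally show ?thesis by simp
  qed
  then show ?thesis using y n by (auto simp: gauss_quadrature_def poly_space_def)
qed

text \<open>
  The nodes are the \<open>n\<close> roots of \<open>\<phi> n\<close> in the interval and the weights are the integrals of the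
  Lagrange basis at these nodes.
\<close>
lemma gauss_quadrature_exists:
  assumes n: "CARD('n) = n" and "is_interval (space M)"
    and "\<And>p. p \<noteq> 0 \<Longrightarrow> AE z in M. poly p z \<noteq> 0"
  shows "\<exists>y w :: real ^ 'n. gauss_quadrature M y w"
proof -
  obtain S where S: "S \<subseteq> space M" "finite S" "card S = n" "\<forall>z\<in>S. poly (\<phi> n) z = 0"
    using phi_has_n_roots assms(2,3) by blast
  obtain f :: "'n \<Rightarrow> real" where f: "bij_betw f UNIV S"
    using S n by (metis finite_same_card_bij finite_class.finite_UNIV)
  define y :: "real ^ 'n" where "y = (\<chi> i. f i)"
  define w :: "real ^ 'n" where "w = (\<chi> i. LINT z|M. poly (lagrange_basis y i) z)"
  have inj: "inj (($) y)" using f by (auto simp: y_def bij_betw_def inj_on_def)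
  have yS: "y $ i \<in> S" for i using f by (auto simp: y_def bij_betw_def)
  have "(\<Sum>i\<in>UNIV. w $ i * poly r (y $ i)) = (LINT z|M. poly r z)" if r: "degree r < n" for r
  proof -
    have "poly r = poly (\<Sum>i\<in>UNIV. smult (poly r (y $ i)) (lagrange_basis y i))"
      using lagrange_interpolation[OF inj, of r] r n by simp
    also have "\<dots> = (\<lambda>z. \<Sum>i\<in>UNIV. poly r (y $ i) * poly (lagrange_basis y i) z)"
      by (simp add: poly_sum fun_eq_iff)
    finally have "poly r = (\<lambda>z. \<Sum>i\<in>UNIV. poly r (y $ i) * poly (lagrange_basis y i) z)" .
    then have "(LINT z|M. poly r z) =
        (LINT z|M. (\<Sum>i\<in>UNIV. poly r (y $ i) * poly (lagrange_basis y i) z))"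
      by (rule arg_cong)
    also have "\<dots> = (\<Sum>i\<in>UNIV. poly r (y $ i) * w $ i)"
    proof (subst Bochner_Integration.integral_sum)
      fix i
      have "integrable M (poly (lagrange_basis y i))"
        using degree_lagrange_basis[of y i] n by (intro integrable_poly) simp
      then show "integrable M (\<lambda>z. poly r (y $ i) * poly (lagrange_basis y i) z)" by simp
    qed (simp add: w_def)
    finally show ?thesis by (simp add: mult.commute)
  qed
  then show ?thesis
    using gauss_quadrature_if_interpolatory[OF n] S yS by blast
qed

section \<open>Exact bilinear quadratures as matrix factorizations\<close>

text \<open>
  Matrices are indexed by the type of the nodes on both sides; the enumeration \<open>e\<close> of that type by
  \<open>0, \<dots>, n - 1\<close> turns a column index into a degree. Evaluating a polynomial of degree below \<open>n\<close> at all
  nodes is this matrix applied to its coefficients in the orthonormal basis.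
\<close>
definition node_matrix :: "('n \<Rightarrow> nat) \<Rightarrow> real ^ 'n \<Rightarrow> real ^ 'n ^ 'n" where
  "node_matrix e x = (\<chi> i k. poly (\<phi> (e k)) (x $ i))"

lemma exact_imp_node_matrix:
  fixes x y :: "real ^ 'n"
  assumes n: "CARD('n) = n" and e: "bij_betw e (UNIV :: 'n set) {..<n}"
    and ex: "(x, y, W) \<in> exact_bqs M"
  shows "transpose (node_matrix e x) ** W ** node_matrix e y = mat 1"
proof -
  have e1: "e k < n" for k using e by (auto simp: bij_betw_def)
  have e2: "e k = e l \<longleftrightarrow> k = l" for k l using e by (auto simp: bij_betw_def inj_on_def)
  have mem: "poly (\<phi> (e k)) \<in> poly_space (CARD('n) - 1)" for k
    using degree_phi[of "e k"] e1[of k] n by (intro poly_in_poly_space) simp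
  have "(transpose (node_matrix e x) ** W ** node_matrix e y) $ k $ l
      = bq_eval (x, y, W) (poly (\<phi> (e k))) (poly (\<phi> (e l)))" for k l
    unfolding matrix_mul_assoc[symmetric]
    by (simp add: node_matrix_def matrix_matrix_mult_def transpose_def inner_vec_def
        matrix_vector_mult_def)
  also have "\<dots> k l = (if k = l then 1 else 0)" for k l
    using ex mem inner_phi[of "e k" "e l"] e1[of k] e1[of l] e2
    by (auto simp: exact_bqs_def simp del: bq_eval.simps)
  finally show ?thesis by (simp add: vec_eq_iff mat_def)
qed

lemma index_enumeration:
  assumes "CARD('n) = n" obtains e where "bij_betw e (UNIV :: 'n::finite set) {..<n}"
  using assms by (metis finite_same_card_bij finite_class.finite_UNIV card_lessThan finite_lessThan)

text \<open>
  A repeated node would give the node matrix two equal rows, although it is invertible.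
\<close>
lemma exact_imp_inj_nodes:
  fixes x y :: "real ^ 'n"
  assumes n: "CARD('n) = n" and ex: "(x, y, W) \<in> exact_bqs M"
  shows "inj (($) y)"
proof (rule injI, rule ccontr)
  fix i j assume eq: "y $ i = y $ j" and ne: "i \<noteq> j"
  obtain e where e: "bij_betw e (UNIV :: 'n set) {..<n}" using index_enumeration[OF n] .
  have "row i (node_matrix e y) = row j (node_matrix e y)"
    by (simp add: row_def node_matrix_def eq)
  then have "det (node_matrix e y) = 0" using det_identical_rows[OF ne] by blast
  moreover have "det (transpose (node_matrix e x) ** W ** node_matrix e y) = 1"
    using exact_imp_node_matrix[OF n e ex] by simp
  ultimately show False by (simp add: det_mul)
qed

text \<open>
  From \<open>A W B = 1\<close>, where \<open>A\<close> is the transposed node matrix of \<open>x\<close>, one reads off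
  \<open>W = A\<^bsup>-1\<^esup> B\<^bsup>-1\<^esup>\<close>, which involves only the nodes.
\<close>
lemma exact_matrix_unique:
  fixes x y :: "real ^ 'n"
  assumes n: "CARD('n) = n" and ex: "(x, y, W) \<in> exact_bqs M" "(x, y, W') \<in> exact_bqs M"
  shows "W = W'"
proof -
  obtain e where e: "bij_betw e (UNIV :: 'n set) {..<n}" using index_enumeration[OF n] .
  define A where "A = transpose (node_matrix e x)"
  define B where "B = node_matrix e y"
  have 1: "A ** W ** B = mat 1" "A ** W' ** B = mat 1"
    using exact_imp_node_matrix[OF n e] ex by (auto simp: A_def B_def)
  have 2: "B ** (A ** W) = mat 1" using 1 matrix_left_right_inverse by blast
  have 3: "W' ** B ** A = mat 1"
    using 1(2) matrix_left_right_inverse by (metis matrix_mul_assoc)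
  have "W = W' ** B ** A ** W" using 3 by simp
  also have "\<dots> = W' ** (B ** (A ** W))" by (simp add: matrix_mul_assoc)
  also have "\<dots> = W'" using 2 by simp
  finally show ?thesis .
qed

text \<open>
  The numbers on the left are the entries of \<open>A W\<close> applied to the vector of values of \<open>g\<close> at \<open>y\<close>,
  where \<open>A\<close> is the transposed node matrix of \<open>x\<close>. Exactness gives \<open>A W\<close> the inverse \<open>B\<close>, so only the
  zero vector of values yields zero.
\<close>
lemma exact_orthogonal_iff_roots:
  fixes x y :: "real ^ 'n"
  assumes n: "CARD('n) = n" and ex: "(x, y, W) \<in> exact_bqs M"
  shows "(\<forall>k<n. bq_eval (x, y, W) (poly (\<phi> k)) g = 0) \<longleftrightarrow> (\<forall>j. g (y $ j) = 0)"
proof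
  assume 0: "\<forall>k<n. bq_eval (x, y, W) (poly (\<phi> k)) g = 0"
  obtain e where e: "bij_betw e (UNIV :: 'n set) {..<n}" using index_enumeration[OF n] .
  define A where "A = transpose (node_matrix e x)"
  define B where "B = node_matrix e y"
  define v :: "real ^ 'n" where "v = (\<chi> j. g (y $ j))"
  have "(A ** W *v v) $ k = bq_eval (x, y, W) (poly (\<phi> (e k))) g" for k
    unfolding matrix_vector_mul_assoc[symmetric]
    by (simp add: A_def v_def node_matrix_def transpose_def inner_vec_def matrix_vector_mult_def)
  then have Av: "A ** W *v v = 0"
    using 0 e by (auto simp: vec_eq_iff bij_betw_def simp del: bq_eval.simps)
  have "B ** (A ** W) = mat 1"
    using exact_imp_node_matrix[OF n e ex] matrix_left_right_inverse by (auto simp: A_def B_def)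
  then have "v = B *v (A ** W *v v)" by (simp add: matrix_vector_mul_assoc)
  then have "v = 0" by (simp add: Av)
  then show "\<forall>j. g (y $ j) = 0" by (simp add: v_def vec_eq_iff)
qed (simp add: matrix_vector_mult_def inner_vec_def)

section \<open>Minimality and Gaussian nodes\<close>

text \<open>
  If the supremum vanishes, then so do the quotients at the pairs \<open>(\<phi> k, \<phi> n)\<close>, whose denominators
  are one; these pairs already force the nodes to be roots. Conversely, the values of every multiple
  of \<open>\<phi> n\<close> vanish at such nodes, so all quotients are zero.
\<close>
lemma bq_sigma_eq_0_iff:
  fixes x y :: "real ^ 'n"
  assumes n: "CARD('n) = n" and ex: "(x, y, W) \<in> exact_bqs M"
  shows "bq_sigma M (line_span (poly (\<phi> n))) (x, y, W) = 0 \<longleftrightarrow> (\<forall>j. poly (\<phi> n) (y $ j) = 0)"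
proof
  assume 0: "bq_sigma M (line_span (poly (\<phi> n))) (x, y, W) = 0"
  have nz: "poly (\<phi> k) \<noteq> (\<lambda>_. 0)" if "k \<le> n" for k
    using phi_nonzero[OF that] by (simp add: poly_all_0_iff_0 fun_eq_iff)
  have "bq_eval (x, y, W) (poly (\<phi> k)) (poly (\<phi> n)) = 0" if k: "k < n" for k
  proof -
    have "poly (\<phi> k) \<in> poly_space (CARD('n) - 1) - {\<lambda>_. 0}"
      using k n degree_phi[of k] nz[of k] by (auto simp: poly_space_def)
    moreover have "poly (\<phi> n) \<in> line_span (poly (\<phi> n)) - {\<lambda>_. 0}"
      using nz[of n] by (auto simp: line_span_def intro!: exI[of _ 1])
    ultimately have "ennreal (\<bar>bq_eval (x, y, W) (poly (\<phi> k)) (poly (\<phi> n))\<bar> /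
        (L2norm M (poly (\<phi> k)) * L2norm M (poly (\<phi> n)))) \<le> 0"
      unfolding 0[symmetric] bq_sigma_def
      by (intro SUP_upper2[of "(poly (\<phi> k), poly (\<phi> n))"]) auto
    then show ?thesis using L2norm_phi[of k] L2norm_phi[of n] k by simp
  qed
  then show "\<forall>j. poly (\<phi> n) (y $ j) = 0"
    using exact_orthogonal_iff_roots[OF n ex] by blast
next
  assume "\<forall>j. poly (\<phi> n) (y $ j) = 0"
  then have "bq_eval (x, y, W) f g = 0" if "g \<in> line_span (poly (\<phi> n))" for f g
    using that by (auto simp: line_span_def matrix_vector_mult_def inner_vec_def)
  then show "bq_sigma M (line_span (poly (\<phi> n))) (x, y, W) = 0"
    unfolding bq_sigma_def
    by (intro antisym SUP_least) (auto simp del: bq_eval.simps)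
qed

lemma bq_eval_diag_matrix:
  "bq_eval (x, y, diag_matrix w) f g = (\<Sum>i\<in>UNIV. w $ i * (f (x $ i) * g (y $ i)))"
  by (simp add: inner_vec_def matrix_vector_mult_def diag_matrix_def if_distrib sum.delta
      mult_ac if_distribR cong: if_cong)

lemma gauss_quadrature_poly:
  fixes x w :: "real ^ 'n"
  assumes "gauss_quadrature M x w" and "degree p \<le> 2 * CARD('n) - 1"
  shows "(\<Sum>i\<in>UNIV. w $ i * poly p (x $ i)) = (LINT z|M. poly p z)"
  using assms by (auto simp: gauss_quadrature_def poly_space_def)

lemma gauss_imp_exact_diag:
  fixes x w :: "real ^ 'n"
  assumes n: "CARD('n) = n" and G: "gauss_quadrature M x w"
  shows "(x, x, diag_matrix w) \<in> exact_bqs M"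
proof -
  have "bq_eval (x, x, diag_matrix w) f g = (LINT z|M. f z * g z)"
    if fg: "f \<in> poly_space (CARD('n) - 1)" "g \<in> poly_space (CARD('n) - 1)" for f g
  proof -
    obtain p q where pq: "f = poly p" "degree p \<le> n - 1" "g = poly q" "degree q \<le> n - 1"
      using fg n by (auto simp: poly_space_def)
    have "degree (p * q) \<le> 2 * CARD('n) - 1"
      using degree_mult_le[of p q] pq n by simp
    then show ?thesis
      using gauss_quadrature_poly[OF G] unfolding bq_eval_diag_matrix pq(1,3) poly_mult[symmetric]
      by blast
  qed
  then show ?thesis
    using G by (auto simp: exact_bqs_def gauss_quadrature_def simp del: bq_eval.simps)
qed

text \<open>
  The products \<open>\<phi> k * \<phi> n\<close> with \<open>k < n\<close> are still integrated exactly. Hence the diagonal bilinear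
  quadrature annihilates all pairs \<open>(\<phi> k, \<phi> n)\<close>, which characterises roots.
\<close>
lemma gauss_imp_roots:
  fixes x w :: "real ^ 'n"
  assumes n: "CARD('n) = n" and G: "gauss_quadrature M x w"
  shows "\<forall>j. poly (\<phi> n) (x $ j) = 0"
proof -
  have "bq_eval (x, x, diag_matrix w) (poly (\<phi> k)) (poly (\<phi> n)) = 0" if k: "k < n" for k
  proof -
    have "degree (\<phi> k * \<phi> n) \<le> 2 * CARD('n) - 1"
      using degree_mult_le[of "\<phi> k" "\<phi> n"] degree_phi[of k] degree_phi[of n] k n by simp
    from gauss_quadrature_poly[OF G this] show ?thesis
      using inner_phi[of k n] k unfolding bq_eval_diag_matrix by simp
  qed
  then show ?thesis
    using exact_orthogonal_iff_roots[OF n gauss_imp_exact_diag[OF n G]] by blast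
qed

lemma exact_roots_imp_gauss:
  fixes x y :: "real ^ 'n"
  assumes n: "CARD('n) = n" and ex: "(x, y, W) \<in> exact_bqs M"
    and y: "\<forall>j. poly (\<phi> n) (y $ j) = 0"
  shows "\<exists>w. gauss_quadrature M y w"
proof -
  \<comment> \<open>The column sums of \<open>W\<close> are the coefficients of the linear form \<open>g \<mapsto> Q(1, g)\<close>.\<close>
  define w :: "real ^ 'n" where "w = (\<chi> j. \<Sum>i\<in>UNIV. W $ i $ j)"
  have "(\<Sum>j\<in>UNIV. w $ j * poly r (y $ j)) = (LINT z|M. poly r z)" if r: "degree r < n" for r
  proof -
    have "(\<Sum>j\<in>UNIV. w $ j * poly r (y $ j)) = bq_eval (x, y, W) (poly 1) (poly r)"
      by (simp add: w_def inner_vec_def matrix_vector_mult_def sum_distrib_right)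
         (rule sum.swap)
    also have "poly 1 \<in> poly_space (CARD('n) - 1)" "poly r \<in> poly_space (CARD('n) - 1)"
      using r n by (intro poly_in_poly_space; simp)+
    then have "bq_eval (x, y, W) (poly 1) (poly r) = (LINT z|M. poly 1 z * poly r z)"
      using ex by (auto simp: exact_bqs_def simp del: bq_eval.simps poly_1)
    finally show ?thesis by simp
  qed
  then have "gauss_quadrature M y w"
    using ex y by (intro gauss_quadrature_if_interpolatory[OF n]) (auto simp: exact_bqs_def)
  then show ?thesis by blast
qed

lemma minimal_iff_gauss:
  fixes x y :: "real ^ 'n"
  assumes n: "CARD('n) = n" and "\<exists>y w :: real ^ 'n. gauss_quadrature M y w"
  shows "minimal_bq M (line_span (poly (\<phi> n))) (x, y, W) \<longleftrightarrow>
    (x, y, W) \<in> exact_bqs M \<and> (\<exists>w. gauss_quadrature M y w)"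
proof -
  let ?\<sigma> = "bq_sigma M (line_span (poly (\<phi> n)))"
  obtain y0 w0 :: "real ^ 'n" where G: "gauss_quadrature M y0 w0" using assms(2) by blast
  let ?Q0 = "(y0, y0, diag_matrix w0)"
  have ex0: "?Q0 \<in> exact_bqs M" using gauss_imp_exact_diag[OF n G] .
  have "?\<sigma> ?Q0 = 0" using bq_sigma_eq_0_iff[OF n ex0] gauss_imp_roots[OF n G] by simp
  then have "minimal_bq M (line_span (poly (\<phi> n))) (x, y, W) \<longleftrightarrow>
      (x, y, W) \<in> exact_bqs M \<and> ?\<sigma> (x, y, W) = 0"
    using ex0 unfolding minimal_bq_def by (metis le_zero_eq zero_le)
  also have "\<dots> \<longleftrightarrow> (x, y, W) \<in> exact_bqs M \<and> (\<exists>w. gauss_quadrature M y w)"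
    using bq_sigma_eq_0_iff[OF n] exact_roots_imp_gauss[OF n] gauss_imp_roots[OF n] by blast
  finally show ?thesis .
qed

text \<open>
  With equal left and right nodes, the diagonal matrix of Gaussian weights is one exact choice of
  \<open>W\<close>, hence the only one.
\<close>
lemma minimal_diagonal_iff:
  fixes x :: "real ^ 'n"
  assumes n: "CARD('n) = n" and "\<exists>y w :: real ^ 'n. gauss_quadrature M y w"
  shows "minimal_bq M (line_span (poly (\<phi> n))) (x, x, W) \<longleftrightarrow>
    (\<exists>w. gauss_quadrature M x w \<and> W = diag_matrix w)"
  unfolding minimal_iff_gauss[OF assms]
  using gauss_imp_exact_diag[OF n] exact_matrix_unique[OF n] by blast

text \<open>
  Both node vectors enumerate the full root set of \<open>\<phi> n\<close>, which gives the permutation. The permuted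
  weights then form a Gaussian quadrature at the second nodes, and uniqueness of the exact matrix
  identifies them with the second weights.
\<close>
lemma gauss_unique_up_to_permutation:
  fixes x x' w w' :: "real ^ 'n"
  assumes n: "CARD('n) = n" and G: "gauss_quadrature M x w" "gauss_quadrature M x' w'"
  shows "\<exists>\<pi>. bij \<pi> \<and> x' = (\<chi> i. x $ \<pi> i) \<and>
    diag_matrix w' = (\<chi> i j. diag_matrix w $ \<pi> i $ \<pi> j)"
proof -
  let ?R = "{z. poly (\<phi> n) z = 0}"
  have enum: "bij_betw (($) u) UNIV ?R" if "gauss_quadrature M u v" for u v :: "real ^ 'n"
  proof -
    have inj: "inj (($) u)"
      using exact_imp_inj_nodes[OF n gauss_imp_exact_diag[OF n that]] .
    have "range (($) u) = ?R"
    proof (rule card_seteq)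
      show "finite ?R" using phi_nonzero poly_roots_finite by blast
      show "range (($) u) \<subseteq> ?R" using gauss_imp_roots[OF n that] by auto
      show "card ?R \<le> card (range (($) u))"
        using card_poly_roots_bound[of "\<phi> n"] phi_nonzero degree_phi n inj
        by (simp add: card_image)
    qed
    then show ?thesis using inj by (simp add: bij_betw_def)
  qed
  define \<pi> where "\<pi> = (\<lambda>i. inv_into UNIV (($) x) (x' $ i))"
  have bij: "bij \<pi>"
    unfolding \<pi>_def
    using bij_betw_trans[OF enum[OF G(2)] bij_betw_inv_into[OF enum[OF G(1)]]]
    by (simp add: o_def)
  have x\<pi>: "x $ \<pi> i = x' $ i" for i
    unfolding \<pi>_def using enum[OF G(1)] enum[OF G(2)]
    by (metis bij_betw_apply bij_betw_imp_surj_on f_inv_into_f UNIV_I)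
  define v :: "real ^ 'n" where "v = (\<chi> i. w $ \<pi> i)"
  have "(\<Sum>i\<in>UNIV. v $ i * p (x' $ i)) = (\<Sum>i\<in>UNIV. w $ i * p (x $ i))" for p
    using sum.reindex_bij_betw[OF bij, of "\<lambda>i. w $ i * p (x $ i)"] by (simp add: v_def x\<pi>)
  then have "gauss_quadrature M x' v" using G by (simp add: gauss_quadrature_def)
  then have "diag_matrix w' = diag_matrix v"
    using exact_matrix_unique[OF n] gauss_imp_exact_diag[OF n] G(2) by blast
  also have "\<dots> = (\<chi> i j. diag_matrix w $ \<pi> i $ \<pi> j)"
    using bij by (simp add: vec_eq_iff diag_matrix_def v_def bij_def inj_eq)
  finally show ?thesis using bij x\<pi> by (auto simp: vec_eq_iff)
qed

end

theorem theorem2p13: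
  fixes I :: "real set" and M :: "real measure" and \<phi> :: "nat \<Rightarrow> real poly"
  assumes "open I" and "is_interval I" and "I \<noteq> {}"
    and "sets M = sets (restrict_space borel I)"
    and "finite_measure M"
    and "absolutely_continuous (restrict_space lborel I) M"
    and "\<forall>p \<in> poly_space (2 * CARD('n::finite) - 1). integrable M p"
    and "orthonormal_polys M CARD('n) \<phi>"
  shows
    "(\<exists>(x :: real ^ 'n) W. minimal_bq M (line_span (poly (\<phi> CARD('n)))) (x, x, W) \<and>
        (\<forall>(x' :: real ^ 'n) W'. minimal_bq M (line_span (poly (\<phi> CARD('n)))) (x', x', W') \<longrightarrow>
           (\<exists>\<pi>. bij \<pi> \<and> x' = (\<chi> i. x $ \<pi> i) \<and> W' = (\<chi> i j. W $ \<pi> i $ \<pi> j)))) \<and>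
     (\<forall>(x :: real ^ 'n) W. minimal_bq M (line_span (poly (\<phi> CARD('n)))) (x, x, W) \<longleftrightarrow>
        (\<exists>w. gauss_quadrature M x w \<and> W = diag_matrix w)) \<and>
     (\<forall>(x :: real ^ 'n) y W. minimal_bq M (line_span (poly (\<phi> CARD('n)))) (x, y, W) \<longleftrightarrow>
        (x, y, W) \<in> exact_bqs M \<and> (\<exists>w. gauss_quadrature M y w))"
proof -
  interpret orthonormal_family M "CARD('n)" \<phi>
    using assms(7,8) by unfold_locales (auto simp: poly_space_def)
  have "space M = I"
    using sets_eq_imp_space_eq[OF assms(4)] by (simp add: space_restrict_space)
  then have ex: "\<exists>y w :: real ^ 'n. gauss_quadrature M y w"
    using assms AE_poly_nonzero[OF assms(1,4,6)] by (intro gauss_quadrature_exists) auto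
  then obtain x w :: "real ^ 'n" where G: "gauss_quadrature M x w" by blast
  note diag = minimal_diagonal_iff[OF refl ex]
  show ?thesis
  proof (intro conjI)
    show "\<exists>(x :: real ^ 'n) W. minimal_bq M (line_span (poly (\<phi> CARD('n)))) (x, x, W) \<and>
        (\<forall>(x' :: real ^ 'n) W'. minimal_bq M (line_span (poly (\<phi> CARD('n)))) (x', x', W') \<longrightarrow>
           (\<exists>\<pi>. bij \<pi> \<and> x' = (\<chi> i. x $ \<pi> i) \<and> W' = (\<chi> i j. W $ \<pi> i $ \<pi> j)))"
      unfolding diag
      by (rule exI[of _ x], rule exI[of _ "diag_matrix w"])
         (use G gauss_unique_up_to_permutation[OF refl G] in blast)
  qed (use diag minimal_iff_gauss[OF refl ex] in blast)+
qed

end
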